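(* (i) If excluded middle holds, then the intrinsic apartness on any dcpo is tight. Conversely, if $D$ is a continuous dcpo having elements $x\sqsubseteq y$ with $x\# y$ (intrinsic apartness), then tightness of the intrinsic apartness on $D$ implies excluded middle. (ii) If excluded middle holds, then the intrinsic apartness on any dcpo is cotransitive. Conversely, if $D$ is a continuous dcpo having elements $x\sqsubseteq y$ with $x\# y$, then cotransitivity of the intrinsic apartness on $D$ implies excluded middle. (iii) In particular, if the intrinsic apartness on the Sierpiński domain $\mathbb S$ is tight or cotransitive, then excluded middle follows.
   Context: We work constructively: informal set theory without excluded middle or choice. A dcpo is a poset in which every directed subset (inhabited, any two elements have an upper bound in it) has a supremum. In a dcpo, $x\ll y$ if for every directed $S$ with $y\sqsubseteq\bigsqcup S$ some $s\in S$ satisfies $x\sqsubseteq s$; $D$ is continuous if for every $x$ the set $\{y\mid y\ll x\}$ is directed with supremum $x$. A subset $U$ is Scott open if it is an upper set and $\bigsqcup S\in U$ for directed $S$ implies some $s\in S$ is in $U$. Write $x\not\leq_{\mathrm S}y$ if some Scott open contains $x$ but not $y$; the intrinsic apartness is $x\# y$ iff ($x\not\leq_{\mathrm S}y$ or $y\not\leq_{\mathrm S}x$). A relation $\#$ is tight if $\neg(x\# y)$ implies $x=y$, and cotransitive if $x\# y$ implies ($x\# z$ or $y\# z$) for all $x,y,z$. The Sierpiński domain $\mathbb S$ is the powerset of a singleton $\{*\}$ ordered by inclusion (suprema are unions). Excluded middle: $P\vee\neg P$ for every proposition $P$. *)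

theory Defs
  imports Main
begin

text \<open>
  The results are statements of constructive mathematics, so formulating them over the type
  \<^typ>\<open>bool\<close> of HOL, where excluded middle is a theorem, would make the implications
  to excluded middle void.  They are formulated over the type \<^typ>\<open>prop\<close> of propositions
  of the Isabelle/Pure meta-logic instead.  Pure is intuitionistic higher-order logic:
  quantification over \<^typ>\<open>prop\<close> is impredicative, functions and propositions are extensional,
  and the remaining connectives have their usual second-order definitions.  The classical axioms
  and the choice operators of HOL concern only \<^typ>\<open>bool\<close> and types of class \<^class>\<open>type\<close>, of
  which \<^typ>\<open>prop\<close> is not an instance; they do not yield excluded middle for \<^typ>\<open>prop\<close>.

  For the same reason all type variables below have the empty sort, equality is \<open>\<equiv>\<close>, and sets
  are predicates with values in \<^typ>\<open>prop\<close>.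
\<close>

subsection \<open>Intuitionistic connectives on \<^typ>\<open>prop\<close>\<close>

definition falsum :: "prop"  ("\<^bold>\<bottom>")
  where "\<^bold>\<bottom> \<equiv> (\<And>C::prop. PROP C)"

definition neg :: "prop \<Rightarrow> prop"  ("\<^bold>\<not> _" [40] 40)
  where "\<^bold>\<not> PROP A \<equiv> (PROP A \<Longrightarrow> \<^bold>\<bottom>)"

definition conj_prop :: "prop \<Rightarrow> prop \<Rightarrow> prop"  (infixr "\<^bold>\<and>" 35)
  where "PROP A \<^bold>\<and> PROP B \<equiv> (\<And>C::prop. (PROP A \<Longrightarrow> PROP B \<Longrightarrow> PROP C) \<Longrightarrow> PROP C)"

definition disj_prop :: "prop \<Rightarrow> prop \<Rightarrow> prop"  (infixr "\<^bold>\<or>" 30)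
  where "PROP A \<^bold>\<or> PROP B \<equiv>
    (\<And>C::prop. (PROP A \<Longrightarrow> PROP C) \<Longrightarrow> (PROP B \<Longrightarrow> PROP C) \<Longrightarrow> PROP C)"

definition ex_prop :: "('a::{} \<Rightarrow> prop) \<Rightarrow> prop"  (binder "\<^bold>\<exists>" 10)
  where "PROP ex_prop P \<equiv> (\<And>C::prop. (\<And>x. PROP P x \<Longrightarrow> PROP C) \<Longrightarrow> PROP C)"

definition excluded_middle :: "prop"
  where "PROP excluded_middle \<equiv> (\<And>P::prop. PROP P \<^bold>\<or> \<^bold>\<not> PROP P)"


subsection \<open>Sets\<close>

type_synonym 'a pset = "'a \<Rightarrow> prop"

abbreviation (input) mem :: "'a::{} \<Rightarrow> 'a pset \<Rightarrow> prop"  (infix "\<^bold>\<in>" 50)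
  where "x \<^bold>\<in> A \<equiv> PROP A x"

definition incl :: "('a::{}) pset \<Rightarrow> 'a pset \<Rightarrow> prop"  (infix "\<^bold>\<subseteq>" 50)
  where "A \<^bold>\<subseteq> B \<equiv> (\<And>x. x \<^bold>\<in> A \<Longrightarrow> x \<^bold>\<in> B)"

definition singleton :: "'a::{} \<Rightarrow> 'a pset"
  where "singleton a \<equiv> (\<lambda>x. (x \<equiv> a))"

definition powerset :: "('a::{}) pset \<Rightarrow> 'a pset pset"
  where "powerset A \<equiv> (\<lambda>B. B \<^bold>\<subseteq> A)"


subsection \<open>Directed-complete posets\<close>

text \<open>
  A structured set is given by its carrier \<open>D\<close>, a subset of some type, and a relation \<open>le\<close>, of
  which only the restriction to \<open>D\<close> matters.
\<close>

definition poset :: "('a::{}) pset \<Rightarrow> ('a \<Rightarrow> 'a \<Rightarrow> prop) \<Rightarrow> prop"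
  where "PROP poset D le \<equiv>
    (\<And>x. x \<^bold>\<in> D \<Longrightarrow> PROP le x x) \<^bold>\<and>
    (\<And>x y z. x \<^bold>\<in> D \<Longrightarrow> y \<^bold>\<in> D \<Longrightarrow> z \<^bold>\<in> D \<Longrightarrow> PROP le x y \<Longrightarrow> PROP le y z \<Longrightarrow> PROP le x z) \<^bold>\<and>
    (\<And>x y. x \<^bold>\<in> D \<Longrightarrow> y \<^bold>\<in> D \<Longrightarrow> PROP le x y \<Longrightarrow> PROP le y x \<Longrightarrow> x \<equiv> y)"

definition directed :: "('a::{}) pset \<Rightarrow> ('a \<Rightarrow> 'a \<Rightarrow> prop) \<Rightarrow> 'a pset \<Rightarrow> prop"
  where "PROP directed D le S \<equiv>
    S \<^bold>\<subseteq> D \<^bold>\<and>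
    (\<^bold>\<exists>x. x \<^bold>\<in> S) \<^bold>\<and>
    (\<And>x y. x \<^bold>\<in> S \<Longrightarrow> y \<^bold>\<in> S \<Longrightarrow> (\<^bold>\<exists>z. z \<^bold>\<in> S \<^bold>\<and> PROP le x z \<^bold>\<and> PROP le y z))"

definition is_sup :: "('a::{}) pset \<Rightarrow> ('a \<Rightarrow> 'a \<Rightarrow> prop) \<Rightarrow> 'a pset \<Rightarrow> 'a \<Rightarrow> prop"
  where "PROP is_sup D le S s \<equiv>
    s \<^bold>\<in> D \<^bold>\<and>
    (\<And>x. x \<^bold>\<in> S \<Longrightarrow> PROP le x s) \<^bold>\<and>
    (\<And>u. u \<^bold>\<in> D \<Longrightarrow> (\<And>x. x \<^bold>\<in> S \<Longrightarrow> PROP le x u) \<Longrightarrow> PROP le s u)"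

definition dcpo :: "('a::{}) pset \<Rightarrow> ('a \<Rightarrow> 'a \<Rightarrow> prop) \<Rightarrow> prop"
  where "PROP dcpo D le \<equiv>
    PROP poset D le \<^bold>\<and>
    (\<And>S. PROP directed D le S \<Longrightarrow> (\<^bold>\<exists>s. PROP is_sup D le S s))"

text \<open>
  There is no description operator for \<^typ>\<open>prop\<close>; a condition on the supremum of \<open>S\<close> is
  rendered as a condition on every \<open>s\<close> with \<open>is_sup D le S s\<close>.  In a dcpo such an \<open>s\<close> exists
  for directed \<open>S\<close>, and it is unique by antisymmetry.
\<close>

definition way_below :: "('a::{}) pset \<Rightarrow> ('a \<Rightarrow> 'a \<Rightarrow> prop) \<Rightarrow> 'a \<Rightarrow> 'a \<Rightarrow> prop"
  where "PROP way_below D le x y \<equiv>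
    (\<And>S s. PROP directed D le S \<Longrightarrow> PROP is_sup D le S s \<Longrightarrow> PROP le y s \<Longrightarrow>
      (\<^bold>\<exists>t. t \<^bold>\<in> S \<^bold>\<and> PROP le x t))"

definition continuous_dcpo :: "('a::{}) pset \<Rightarrow> ('a \<Rightarrow> 'a \<Rightarrow> prop) \<Rightarrow> prop"
  where "PROP continuous_dcpo D le \<equiv>
    PROP dcpo D le \<^bold>\<and>
    (\<And>x. x \<^bold>\<in> D \<Longrightarrow>
      PROP directed D le (\<lambda>y. y \<^bold>\<in> D \<^bold>\<and> PROP way_below D le y x) \<^bold>\<and>
      PROP is_sup D le (\<lambda>y. y \<^bold>\<in> D \<^bold>\<and> PROP way_below D le y x) x)"


subsection \<open>Scott topology and intrinsic apartness\<close>

definition scott_open :: "('a::{}) pset \<Rightarrow> ('a \<Rightarrow> 'a \<Rightarrow> prop) \<Rightarrow> 'a pset \<Rightarrow> prop"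
  where "PROP scott_open D le U \<equiv>
    U \<^bold>\<subseteq> D \<^bold>\<and>
    (\<And>x y. x \<^bold>\<in> U \<Longrightarrow> y \<^bold>\<in> D \<Longrightarrow> PROP le x y \<Longrightarrow> y \<^bold>\<in> U) \<^bold>\<and>
    (\<And>S s. PROP directed D le S \<Longrightarrow> PROP is_sup D le S s \<Longrightarrow> s \<^bold>\<in> U \<Longrightarrow>
      (\<^bold>\<exists>t. t \<^bold>\<in> S \<^bold>\<and> t \<^bold>\<in> U))"

definition not_below_scott :: "('a::{}) pset \<Rightarrow> ('a \<Rightarrow> 'a \<Rightarrow> prop) \<Rightarrow> 'a \<Rightarrow> 'a \<Rightarrow> prop"
  where "PROP not_below_scott D le x y \<equiv>
    (\<^bold>\<exists>U. PROP scott_open D le U \<^bold>\<and> x \<^bold>\<in> U \<^bold>\<and> \<^bold>\<not> y \<^bold>\<in> U)"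

definition apart :: "('a::{}) pset \<Rightarrow> ('a \<Rightarrow> 'a \<Rightarrow> prop) \<Rightarrow> 'a \<Rightarrow> 'a \<Rightarrow> prop"
  where "PROP apart D le x y \<equiv>
    PROP not_below_scott D le x y \<^bold>\<or> PROP not_below_scott D le y x"

definition tight :: "('a::{}) pset \<Rightarrow> ('a \<Rightarrow> 'a \<Rightarrow> prop) \<Rightarrow> prop"
  where "PROP tight D R \<equiv>
    (\<And>x y. x \<^bold>\<in> D \<Longrightarrow> y \<^bold>\<in> D \<Longrightarrow> \<^bold>\<not> PROP R x y \<Longrightarrow> x \<equiv> y)"

definition cotransitive :: "('a::{}) pset \<Rightarrow> ('a \<Rightarrow> 'a \<Rightarrow> prop) \<Rightarrow> prop"
  where "PROP cotransitive D R \<equiv>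
    (\<And>x y z. x \<^bold>\<in> D \<Longrightarrow> y \<^bold>\<in> D \<Longrightarrow> z \<^bold>\<in> D \<Longrightarrow> PROP R x y \<Longrightarrow>
      PROP R x z \<^bold>\<or> PROP R y z)"

text \<open>
  The singleton type of HOL serves as \<open>{*}\<close>.  Its subsets are \<^typ>\<open>prop\<close>-valued predicates, so
  the Sierpinski domain has an element for every proposition.
\<close>

definition Sierpinski :: "unit pset pset"
  where "Sierpinski \<equiv> powerset (singleton ())"

end

theory Submission
  imports Defs
begin

text \<open>
  For elements \<open>x \<sqsubseteq> y\<close> of a dcpo and a proposition \<open>P\<close>, the set \<open>{x} \<union> {y | P}\<close> is directed; let
  \<open>s\<close> be its supremum.  If \<open>P\<close> holds then \<open>s = y\<close>, and if some Scott open set contains \<open>s\<close> but not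
  \<open>x\<close> then \<open>P\<close> holds.  When \<open>x # y\<close>, tightness applied to \<open>s\<close> and \<open>y\<close> therefore yields \<open>P\<close> from
  \<open>\<not>\<not>P\<close>, and cotransitivity applied to \<open>x\<close>, \<open>y\<close> and \<open>s\<close> decides \<open>P\<close>.  Classically,
  \<open>{z | \<not> z \<sqsubseteq> y}\<close> is Scott open, which gives tightness.
\<close>

subsection \<open>Natural deduction on \<^typ>\<open>prop\<close>\<close>

lemma falsumE: "\<^bold>\<bottom> \<Longrightarrow> PROP C"
  unfolding falsum_def .

lemma negI: "(PROP A \<Longrightarrow> \<^bold>\<bottom>) \<Longrightarrow> \<^bold>\<not> PROP A"
  unfolding neg_def .

lemma negD: "\<^bold>\<not> PROP A \<Longrightarrow> PROP A \<Longrightarrow> \<^bold>\<bottom>"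
  unfolding neg_def .

lemma negE: "\<^bold>\<not> PROP A \<Longrightarrow> PROP A \<Longrightarrow> PROP C"
  by (rule falsumE) (rule negD)

lemma conj_propI: "PROP A \<Longrightarrow> PROP B \<Longrightarrow> PROP A \<^bold>\<and> PROP B"
  unfolding conj_prop_def
proof -
  fix C :: "prop"
  assume a: "PROP A" and b: "PROP B" and c: "PROP A \<Longrightarrow> PROP B \<Longrightarrow> PROP C"
  show "PROP C"
    by (rule c[OF a b])
qed

lemma conj_propD1: "PROP A \<^bold>\<and> PROP B \<Longrightarrow> PROP A"
  unfolding conj_prop_def
proof -
  assume "\<And>C::prop. (PROP A \<Longrightarrow> PROP B \<Longrightarrow> PROP C) \<Longrightarrow> PROP C"
  then show "PROP A" .
qed

lemma conj_propD2: "PROP A \<^bold>\<and> PROP B \<Longrightarrow> PROP B"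
  unfolding conj_prop_def
proof -
  assume "\<And>C::prop. (PROP A \<Longrightarrow> PROP B \<Longrightarrow> PROP C) \<Longrightarrow> PROP C"
  then show "PROP B" .
qed

lemma conj_propE: "PROP A \<^bold>\<and> PROP B \<Longrightarrow> (PROP A \<Longrightarrow> PROP B \<Longrightarrow> PROP C) \<Longrightarrow> PROP C"
  unfolding conj_prop_def
proof -
  assume *: "\<And>C::prop. (PROP A \<Longrightarrow> PROP B \<Longrightarrow> PROP C) \<Longrightarrow> PROP C"
    and c: "PROP A \<Longrightarrow> PROP B \<Longrightarrow> PROP C"
  show "PROP C"
    by (rule *) (rule c)
qed

lemma disj_propI1: "PROP A \<Longrightarrow> PROP A \<^bold>\<or> PROP B"
  unfolding disj_prop_def
proof -
  fix C :: "prop"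
  assume a: "PROP A" and c: "PROP A \<Longrightarrow> PROP C"
  show "PROP C"
    by (rule c[OF a])
qed

lemma disj_propI2: "PROP B \<Longrightarrow> PROP A \<^bold>\<or> PROP B"
  unfolding disj_prop_def
proof -
  fix C :: "prop"
  assume b: "PROP B" and c: "PROP B \<Longrightarrow> PROP C"
  show "PROP C"
    by (rule c[OF b])
qed

lemma disj_propE:
  "PROP A \<^bold>\<or> PROP B \<Longrightarrow> (PROP A \<Longrightarrow> PROP C) \<Longrightarrow> (PROP B \<Longrightarrow> PROP C) \<Longrightarrow> PROP C"
  unfolding disj_prop_def
proof -
  assume *: "\<And>C::prop. (PROP A \<Longrightarrow> PROP C) \<Longrightarrow> (PROP B \<Longrightarrow> PROP C) \<Longrightarrow> PROP C"
    and a: "PROP A \<Longrightarrow> PROP C" and b: "PROP B \<Longrightarrow> PROP C"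
  show "PROP C"
    by (rule *) (erule a, erule b)
qed

lemma ex_propI:
  fixes P :: "'a::{} \<Rightarrow> prop"
  shows "PROP P x \<Longrightarrow> PROP ex_prop P"
  unfolding ex_prop_def
proof -
  fix C :: "prop"
  assume p: "PROP P x" and c: "\<And>x. PROP P x \<Longrightarrow> PROP C"
  show "PROP C"
    by (rule c[OF p])
qed

lemma ex_propE:
  fixes P :: "'a::{} \<Rightarrow> prop"
  shows "PROP ex_prop P \<Longrightarrow> (\<And>x. PROP P x \<Longrightarrow> PROP C) \<Longrightarrow> PROP C"
  unfolding ex_prop_def
proof -
  assume *: "\<And>C::prop. (\<And>x. PROP P x \<Longrightarrow> PROP C) \<Longrightarrow> PROP C"
    and c: "\<And>x. PROP P x \<Longrightarrow> PROP C"
  show "PROP C"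
    by (rule *) (rule c)
qed

lemma excluded_middleD: "PROP excluded_middle \<Longrightarrow> PROP P \<^bold>\<or> \<^bold>\<not> PROP P"
  unfolding excluded_middle_def .

lemma by_contradiction:
  assumes em: "PROP excluded_middle" and contr: "\<^bold>\<not> PROP P \<Longrightarrow> \<^bold>\<bottom>"
  shows "PROP P"
  using excluded_middleD[OF em, of "PROP P"]
proof (rule disj_propE)
  assume "PROP P"
  then show "PROP P" .
next
  assume "\<^bold>\<not> PROP P"
  then show "PROP P"
    by (rule falsumE[OF contr])
qed

text \<open>The double negation of every instance of excluded middle is intuitionistically provable:
  a refutation of the disjunction refutes \<open>P\<close>, and a refutation of \<open>P\<close>
  proves its second disjunct. So stability of all propositions suffices.\<close>

lemma excluded_middle_if_double_negation:
  assumes dn: "\<And>P::prop. \<^bold>\<not> \<^bold>\<not> PROP P \<Longrightarrow> PROP P"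
  shows "PROP excluded_middle"
  unfolding excluded_middle_def
proof (rule dn)
  fix P :: "prop"
  show "\<^bold>\<not> \<^bold>\<not> (PROP P \<^bold>\<or> \<^bold>\<not> PROP P)"
  proof (rule negI)
    assume n: "\<^bold>\<not> (PROP P \<^bold>\<or> \<^bold>\<not> PROP P)"
    have "\<^bold>\<not> PROP P"
    proof (rule negI)
      assume "PROP P"
      then show "\<^bold>\<bottom>"
        by (rule negD[OF n disj_propI1])
    qed
    then show "\<^bold>\<bottom>"
      by (rule negD[OF n disj_propI2])
  qed
qed


subsection \<open>Directed-complete posets and Scott open sets\<close>

lemma inclI:
  fixes A B :: "('a::{}) pset"
  shows "(\<And>x. x \<^bold>\<in> A \<Longrightarrow> x \<^bold>\<in> B) \<Longrightarrow> A \<^bold>\<subseteq> B"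
  unfolding incl_def .

lemma inclD:
  fixes A B :: "('a::{}) pset"
  shows "A \<^bold>\<subseteq> B \<Longrightarrow> x \<^bold>\<in> A \<Longrightarrow> x \<^bold>\<in> B"
  unfolding incl_def .

lemma poset_refl:
  fixes D :: "('a::{}) pset"
  assumes "PROP poset D le" and "x \<^bold>\<in> D"
  shows "PROP le x x"
  by (rule assms(1)[unfolded poset_def, THEN conj_propD1, rule_format, OF assms(2)])

lemma poset_trans:
  fixes D :: "('a::{}) pset"
  assumes "PROP poset D le"
    and "x \<^bold>\<in> D" and "y \<^bold>\<in> D" and "z \<^bold>\<in> D" and "PROP le x y" and "PROP le y z"
  shows "PROP le x z"
  by (rule assms(1)[unfolded poset_def, THEN conj_propD2, THEN conj_propD1, rule_format, OF assms(2-)])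

lemma poset_antisym:
  fixes D :: "('a::{}) pset"
  assumes "PROP poset D le" and "x \<^bold>\<in> D" and "y \<^bold>\<in> D" and "PROP le x y" and "PROP le y x"
  shows "x \<equiv> y"
  by (rule assms(1)[unfolded poset_def, THEN conj_propD2, THEN conj_propD2, rule_format, OF assms(2-)])

lemma directed_subset:
  fixes D :: "('a::{}) pset"
  assumes "PROP directed D le S" and "x \<^bold>\<in> S"
  shows "x \<^bold>\<in> D"
  by (rule inclD[OF assms(1)[unfolded directed_def, THEN conj_propD1] assms(2)])

lemma is_sup_in:
  fixes D :: "('a::{}) pset"
  assumes "PROP is_sup D le S s"
  shows "s \<^bold>\<in> D"
  by (rule assms[unfolded is_sup_def, THEN conj_propD1])

lemma is_sup_upper:
  fixes D :: "('a::{}) pset"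
  assumes "PROP is_sup D le S s" and "x \<^bold>\<in> S"
  shows "PROP le x s"
  by (rule assms(1)[unfolded is_sup_def, THEN conj_propD2, THEN conj_propD1, rule_format, OF assms(2)])

lemma is_sup_least:
  fixes D :: "('a::{}) pset"
  assumes "PROP is_sup D le S s" and "u \<^bold>\<in> D" and "\<And>x. x \<^bold>\<in> S \<Longrightarrow> PROP le x u"
  shows "PROP le s u"
  by (rule assms(1)[unfolded is_sup_def, THEN conj_propD2, THEN conj_propD2, rule_format, OF assms(2,3)])

lemma dcpo_poset:
  fixes D :: "('a::{}) pset"
  assumes "PROP dcpo D le"
  shows "PROP poset D le"
  by (rule assms[unfolded dcpo_def, THEN conj_propD1])

lemma dcpo_sup:
  fixes D :: "('a::{}) pset"
  assumes "PROP dcpo D le" and "PROP directed D le S"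
  shows "\<^bold>\<exists>s. PROP is_sup D le S s"
  by (rule assms(1)[unfolded dcpo_def, THEN conj_propD2, rule_format, OF assms(2)])

lemma continuous_dcpo_dcpo:
  fixes D :: "('a::{}) pset"
  assumes "PROP continuous_dcpo D le"
  shows "PROP dcpo D le"
  by (rule assms[unfolded continuous_dcpo_def, THEN conj_propD1])

section \<open>Scott open sets\<close>

lemma scott_open_upper:
  fixes D :: "('a::{}) pset"
  assumes "PROP scott_open D le U" and "x \<^bold>\<in> U" and "y \<^bold>\<in> D" and "PROP le x y"
  shows "y \<^bold>\<in> U"
  by (rule assms(1)[unfolded scott_open_def, THEN conj_propD2, THEN conj_propD1, rule_format, OF assms(2-)])

lemma scott_open_sup:
  fixes D :: "('a::{}) pset"
  assumes "PROP scott_open D le U"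
    and "PROP directed D le S" and "PROP is_sup D le S s" and "s \<^bold>\<in> U"
  shows "\<^bold>\<exists>t. t \<^bold>\<in> S \<^bold>\<and> t \<^bold>\<in> U"
  by (rule assms(1)[unfolded scott_open_def, THEN conj_propD2, THEN conj_propD2, rule_format, OF assms(2-)])

lemma scott_openI:
  fixes D :: "('a::{}) pset"
  assumes "\<And>x. x \<^bold>\<in> U \<Longrightarrow> x \<^bold>\<in> D"
    and "\<And>x y. x \<^bold>\<in> U \<Longrightarrow> y \<^bold>\<in> D \<Longrightarrow> PROP le x y \<Longrightarrow> y \<^bold>\<in> U"
    and "\<And>S s. PROP directed D le S \<Longrightarrow> PROP is_sup D le S s \<Longrightarrow> s \<^bold>\<in> U \<Longrightarrow>
      \<^bold>\<exists>t. t \<^bold>\<in> S \<^bold>\<and> t \<^bold>\<in> U"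
  shows "PROP scott_open D le U"
  unfolding scott_open_def
  by (rule conj_propI, rule inclI, erule assms(1), rule conj_propI, erule (2) assms(2),
      erule (2) assms(3))

section \<open>Separation by Scott open sets and the intrinsic apartness\<close>

lemma not_below_scottI:
  fixes D :: "('a::{}) pset"
  assumes "PROP scott_open D le U" and "x \<^bold>\<in> U" and "\<^bold>\<not> y \<^bold>\<in> U"
  shows "PROP not_below_scott D le x y"
  unfolding not_below_scott_def
  by (rule ex_propI[of _ U]) (rule conj_propI[OF assms(1) conj_propI[OF assms(2,3)]])

lemma not_below_scottE:
  fixes D :: "('a::{}) pset"
  assumes nb: "PROP not_below_scott D le x y"
    and C: "\<And>U. PROP scott_open D le U \<Longrightarrow> x \<^bold>\<in> U \<Longrightarrow> \<^bold>\<not> y \<^bold>\<in> U \<Longrightarrow> PROP C"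
  shows "PROP C"
  using nb[unfolded not_below_scott_def]
proof (rule ex_propE)
  fix U
  assume U: "PROP scott_open D le U \<^bold>\<and> x \<^bold>\<in> U \<^bold>\<and> \<^bold>\<not> y \<^bold>\<in> U"
  show "PROP C"
    by (rule C[OF conj_propD1[OF U] conj_propD1[OF conj_propD2[OF U]]
          conj_propD2[OF conj_propD2[OF U]]])
qed

lemma apartI1:
  fixes D :: "('a::{}) pset"
  assumes "PROP not_below_scott D le x y"
  shows "PROP apart D le x y"
  unfolding apart_def by (rule disj_propI1[OF assms])

lemma apartI2:
  fixes D :: "('a::{}) pset"
  assumes "PROP not_below_scott D le y x"
  shows "PROP apart D le x y"
  unfolding apart_def by (rule disj_propI2[OF assms])

text \<open>Either disjunct of apartness would provide a Scott open set that both contains and omits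
  \<open>x\<close>.\<close>

lemma apart_irrefl:
  fixes D :: "('a::{}) pset"
  shows "\<^bold>\<not> PROP apart D le x x"
proof (rule negI)
  have irrefl: "\<^bold>\<bottom>" if "PROP not_below_scott D le x x"
    using that
  proof (rule not_below_scottE)
    fix U
    assume "x \<^bold>\<in> U" and "\<^bold>\<not> x \<^bold>\<in> U"
    show "\<^bold>\<bottom>"
      by (rule negD[OF \<open>\<^bold>\<not> x \<^bold>\<in> U\<close> \<open>x \<^bold>\<in> U\<close>])
  qed
  assume "PROP apart D le x x"
  from this[unfolded apart_def] show "\<^bold>\<bottom>"
    by (rule disj_propE) (erule irrefl, erule irrefl)
qed

text \<open>Scott open sets are upper sets, so none contains \<open>x\<close> and omits an element
  above it. For comparable elements this fixes which disjunct of the apartness holds,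
  constructively.\<close>

lemma apart_above:
  fixes D :: "('a::{}) pset"
  assumes y: "y \<^bold>\<in> D" and le: "PROP le x y" and ap: "PROP apart D le x y"
  shows "PROP not_below_scott D le y x"
  using ap[unfolded apart_def]
proof (rule disj_propE)
  assume "PROP not_below_scott D le x y"
  then show "PROP not_below_scott D le y x"
  proof (rule not_below_scottE)
    fix U
    assume U: "PROP scott_open D le U" and x: "x \<^bold>\<in> U" and n: "\<^bold>\<not> y \<^bold>\<in> U"
    show "PROP not_below_scott D le y x"
      by (rule negE[OF n scott_open_upper[OF U x y le]])
  qed
next
  assume "PROP not_below_scott D le y x"
  then show "PROP not_below_scott D le y x" .
qed


subsection \<open>Consequences of excluded middle\<close>

text \<open>The complement of the principal lower set of \<open>y\<close> is an upper set by
  transitivity. Excluded middle enters in the condition on directed suprema: if no member of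
  \<open>S\<close> lay in the complement, \<open>y\<close> would be an upper bound of
  \<open>S\<close> and hence above its supremum.\<close>

lemma scott_open_not_below:
  fixes D :: "('a::{}) pset"
  assumes em: "PROP excluded_middle" and po: "PROP poset D le" and y: "y \<^bold>\<in> D"
  shows "PROP scott_open D le (\<lambda>z. z \<^bold>\<in> D \<^bold>\<and> \<^bold>\<not> PROP le z y)"
proof (rule scott_openI)
  fix z
  assume "z \<^bold>\<in> D \<^bold>\<and> \<^bold>\<not> PROP le z y"
  then show "z \<^bold>\<in> D"
    by (rule conj_propD1)
next
  fix z w
  assume z: "z \<^bold>\<in> D \<^bold>\<and> \<^bold>\<not> PROP le z y" and w: "w \<^bold>\<in> D" and zw: "PROP le z w"
  have "\<^bold>\<not> PROP le w y"
  proof (rule negI)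
    assume wy: "PROP le w y"
    show "\<^bold>\<bottom>"
      by (rule negD[OF conj_propD2[OF z] poset_trans[OF po conj_propD1[OF z] w y zw wy]])
  qed
  then show "w \<^bold>\<in> D \<^bold>\<and> \<^bold>\<not> PROP le w y"
    by (rule conj_propI[OF w])
next
  fix S s
  assume dir: "PROP directed D le S" and sup: "PROP is_sup D le S s"
    and s: "s \<^bold>\<in> D \<^bold>\<and> \<^bold>\<not> PROP le s y"
  show "\<^bold>\<exists>t. t \<^bold>\<in> S \<^bold>\<and> t \<^bold>\<in> D \<^bold>\<and> \<^bold>\<not> PROP le t y"
  \<comment> \<open>Constructively one only learns that not all members of \<open>S\<close> are
    below \<open>y\<close>; excluded middle turns this into a member that is not.\<close>
  proof (rule by_contradiction[OF em])
    assume n: "\<^bold>\<not> (\<^bold>\<exists>t. t \<^bold>\<in> S \<^bold>\<and> t \<^bold>\<in> D \<^bold>\<and> \<^bold>\<not> PROP le t y)"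
    have "PROP le s y"
    proof (rule is_sup_least[OF sup y])
      fix t
      assume t: "t \<^bold>\<in> S"
      show "PROP le t y"
      \<comment> \<open>The second classical step: \<open>le t y\<close> is obtained from its double
        negation.\<close>
      proof (rule by_contradiction[OF em])
        assume ty: "\<^bold>\<not> PROP le t y"
        have "\<^bold>\<exists>t. t \<^bold>\<in> S \<^bold>\<and> t \<^bold>\<in> D \<^bold>\<and> \<^bold>\<not> PROP le t y"
          by (rule ex_propI[of _ t])
            (rule conj_propI[OF t conj_propI[OF directed_subset[OF dir t] ty]])
        then show "\<^bold>\<bottom>"
          by (rule negD[OF n])
      qed
    qed
    then show "\<^bold>\<bottom>"
      by (rule negD[OF conj_propD2[OF s]])
  qed
qed

text \<open>If \<open>x\<close> were not below \<open>y\<close>, the Scott open set of elements not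
  below \<open>y\<close> would separate \<open>x\<close> from \<open>y\<close>. Classically, the
  order is thus recovered from the Scott topology.\<close>

lemma excluded_middle_imp_le:
  fixes D :: "('a::{}) pset"
  assumes em: "PROP excluded_middle" and po: "PROP poset D le"
    and x: "x \<^bold>\<in> D" and y: "y \<^bold>\<in> D" and nb: "\<^bold>\<not> PROP not_below_scott D le x y"
  shows "PROP le x y"
proof (rule by_contradiction[OF em])
  assume n: "\<^bold>\<not> PROP le x y"
  have "PROP not_below_scott D le x y"
  proof (rule not_below_scottI[OF scott_open_not_below[OF em po y]])
    show "x \<^bold>\<in> D \<^bold>\<and> \<^bold>\<not> PROP le x y"
      by (rule conj_propI[OF x n])
    show "\<^bold>\<not> (y \<^bold>\<in> D \<^bold>\<and> \<^bold>\<not> PROP le y y)"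
    proof (rule negI)
      assume "y \<^bold>\<in> D \<^bold>\<and> \<^bold>\<not> PROP le y y"
      then show "\<^bold>\<bottom>"
        by (rule negD[OF conj_propD2 poset_refl[OF po y]])
    qed
  qed
  then show "\<^bold>\<bottom>"
    by (rule negD[OF nb])
qed

text \<open>Failure of apartness refutes both of its disjuncts, so the order is recovered in both
  directions and antisymmetry applies.\<close>

lemma excluded_middle_imp_tight:
  fixes D :: "('a::{}) pset"
  assumes em: "PROP excluded_middle" and dcpo: "PROP dcpo D le"
  shows "PROP tight D (apart D le)"
  unfolding tight_def
proof -
  fix x y
  assume x: "x \<^bold>\<in> D" and y: "y \<^bold>\<in> D" and n: "\<^bold>\<not> PROP apart D le x y"
  note po = dcpo_poset[OF dcpo]
  have "PROP le x y"
  proof (rule excluded_middle_imp_le[OF em po x y negI])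
    assume "PROP not_below_scott D le x y"
    then show "\<^bold>\<bottom>"
      by (rule negD[OF n apartI1])
  qed
  moreover have "PROP le y x"
  proof (rule excluded_middle_imp_le[OF em po y x negI])
    assume "PROP not_below_scott D le y x"
    then show "\<^bold>\<bottom>"
      by (rule negD[OF n apartI2])
  qed
  ultimately show "x \<equiv> y"
    by (rule poset_antisym[OF po x y])
qed

text \<open>Excluded middle decides whether \<open>z\<close> belongs to the separating set
  \<open>U\<close>: if it does, \<open>U\<close> separates \<open>z\<close> from \<open>y\<close>,
  otherwise it separates \<open>x\<close> from \<open>z\<close>.\<close>

lemma not_below_scott_cotransitive:
  fixes D :: "('a::{}) pset"
  assumes em: "PROP excluded_middle" and nb: "PROP not_below_scott D le x y"
  shows "PROP not_below_scott D le x z \<^bold>\<or> PROP not_below_scott D le z y"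
  using nb
proof (rule not_below_scottE)
  fix U
  assume U: "PROP scott_open D le U" and x: "x \<^bold>\<in> U" and y: "\<^bold>\<not> y \<^bold>\<in> U"
  show "PROP not_below_scott D le x z \<^bold>\<or> PROP not_below_scott D le z y"
    using excluded_middleD[OF em, of "z \<^bold>\<in> U"]
  proof (rule disj_propE)
    assume "z \<^bold>\<in> U"
    then show "PROP not_below_scott D le x z \<^bold>\<or> PROP not_below_scott D le z y"
      by (rule disj_propI2[OF not_below_scottI[OF U _ y]])
  next
    assume "\<^bold>\<not> z \<^bold>\<in> U"
    then show "PROP not_below_scott D le x z \<^bold>\<or> PROP not_below_scott D le z y"
      by (rule disj_propI1[OF not_below_scottI[OF U x]])
  qed
qed

lemma excluded_middle_imp_cotransitive:
  fixes D :: "('a::{}) pset"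
  assumes em: "PROP excluded_middle"
  shows "PROP cotransitive D (apart D le)"
  unfolding cotransitive_def
proof -
  fix x y z
  assume "PROP apart D le x y"
  from this[unfolded apart_def] show "PROP apart D le x z \<^bold>\<or> PROP apart D le y z"
  proof (rule disj_propE)
    assume "PROP not_below_scott D le x y"
    from not_below_scott_cotransitive[OF em this, of z]
    show "PROP apart D le x z \<^bold>\<or> PROP apart D le y z"
      by (rule disj_propE) (erule disj_propI1[OF apartI1], erule disj_propI2[OF apartI2])
  next
    assume "PROP not_below_scott D le y x"
    \<comment> \<open>Here the separation runs from \<open>y\<close> to \<open>x\<close>, so the
      alternatives come out swapped: \<open>y\<close> separated from \<open>z\<close> gives the
      second disjunct, \<open>z\<close> separated from \<open>x\<close> the first.\<close>
    from not_below_scott_cotransitive[OF em this, of z]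
    show "PROP apart D le x z \<^bold>\<or> PROP apart D le y z"
      by (rule disj_propE) (erule disj_propI2[OF apartI1], erule disj_propI1[OF apartI2])
  qed
qed


subsection \<open>Excluded middle from tightness or cotransitivity\<close>

definition conditional_pair :: "'a::{} \<Rightarrow> 'a \<Rightarrow> prop \<Rightarrow> 'a pset"
  where "conditional_pair x y P \<equiv> (\<lambda>z. (z \<equiv> x) \<^bold>\<or> ((z \<equiv> y) \<^bold>\<and> PROP P))"

lemma conditional_pair_left:
  fixes x y :: "'a::{}"
  shows "x \<^bold>\<in> conditional_pair x y (PROP P)"
  unfolding conditional_pair_def by (rule disj_propI1) (rule reflexive)

lemma conditional_pair_right:
  fixes x y :: "'a::{}"
  assumes "PROP P"
  shows "y \<^bold>\<in> conditional_pair x y (PROP P)"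
  unfolding conditional_pair_def
  by (rule disj_propI2[OF conj_propI[OF _ assms]]) (rule reflexive)

lemma conditional_pairE:
  fixes x y :: "'a::{}"
  assumes z: "z \<^bold>\<in> conditional_pair x y (PROP P)"
    and left: "z \<equiv> x \<Longrightarrow> PROP C" and right: "z \<equiv> y \<Longrightarrow> PROP P \<Longrightarrow> PROP C"
  shows "PROP C"
  using z[unfolded conditional_pair_def]
proof (rule disj_propE)
  assume "z \<equiv> x"
  then show "PROP C"
    by (rule left)
next
  assume "(z \<equiv> y) \<^bold>\<and> PROP P"
  then show "PROP C"
    by (rule conj_propE) (rule right)
qed

lemma conditional_pair_le:
  fixes D :: "('a::{}) pset"
  assumes po: "PROP poset D le" and y: "y \<^bold>\<in> D" and le: "PROP le x y"
    and z: "z \<^bold>\<in> conditional_pair x y (PROP P)"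
  shows "PROP le z y"
  using z
proof (rule conditional_pairE)
  assume "z \<equiv> x"
  show "PROP le z y"
    unfolding \<open>z \<equiv> x\<close> by (rule le)
next
  assume "z \<equiv> y"
  show "PROP le z y"
    unfolding \<open>z \<equiv> y\<close> by (rule poset_refl[OF po y])
qed

text \<open>No decision of \<open>P\<close> is required: \<open>x\<close> is a member
  unconditionally, and any member presented as \<open>y\<close> brings a proof of \<open>P\<close>
  with it, which makes \<open>y\<close> available as an upper bound.\<close>

lemma conditional_pair_directed:
  fixes D :: "('a::{}) pset"
  assumes po: "PROP poset D le" and x: "x \<^bold>\<in> D" and y: "y \<^bold>\<in> D" and le: "PROP le x y"
  shows "PROP directed D le (conditional_pair x y (PROP P))" (is "PROP directed D le ?S")
  unfolding directed_def
proof (rule conj_propI[OF inclI conj_propI])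
  fix z
  assume "z \<^bold>\<in> ?S"
  then show "z \<^bold>\<in> D"
  proof (rule conditional_pairE)
    assume "z \<equiv> x"
    show "z \<^bold>\<in> D"
      unfolding \<open>z \<equiv> x\<close> by (rule x)
  next
    assume "z \<equiv> y"
    show "z \<^bold>\<in> D"
      unfolding \<open>z \<equiv> y\<close> by (rule y)
  qed
next
  show "\<^bold>\<exists>z. z \<^bold>\<in> ?S"
    by (rule ex_propI) (rule conditional_pair_left)
next
  fix z w
  assume z: "z \<^bold>\<in> ?S" and w: "w \<^bold>\<in> ?S"
  \<comment> \<open>Covers each case in which one of \<open>z\<close> and \<open>w\<close> equals
    \<open>y\<close>, since such a case supplies \<open>P\<close>.\<close>
  have bound_y: "\<^bold>\<exists>v. v \<^bold>\<in> ?S \<^bold>\<and> PROP le z v \<^bold>\<and> PROP le w v" if P: "PROP P"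
    by (rule ex_propI[of _ y])
      (rule conj_propI[OF conditional_pair_right[OF P]
          conj_propI[OF conditional_pair_le[OF po y le z] conditional_pair_le[OF po y le w]]])
  show "\<^bold>\<exists>v. v \<^bold>\<in> ?S \<^bold>\<and> PROP le z v \<^bold>\<and> PROP le w v"
    using z
  proof (rule conditional_pairE)
    assume zx: "z \<equiv> x"
    show "\<^bold>\<exists>v. v \<^bold>\<in> ?S \<^bold>\<and> PROP le z v \<^bold>\<and> PROP le w v"
      using w
    proof (rule conditional_pairE)
      assume wx: "w \<equiv> x"
      show "\<^bold>\<exists>v. v \<^bold>\<in> ?S \<^bold>\<and> PROP le z v \<^bold>\<and> PROP le w v"
        unfolding zx wx
        by (rule ex_propI[of _ x])
          (rule conj_propI[OF conditional_pair_left
              conj_propI[OF poset_refl[OF po x] poset_refl[OF po x]]])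
    qed (rule bound_y)
  qed (rule bound_y)
qed

text \<open>Given \<open>P\<close>, the element \<open>y\<close> is both a member and an upper bound
  of the pair, hence its greatest element.\<close>

lemma conditional_pair_sup_eq:
  fixes D :: "('a::{}) pset"
  assumes po: "PROP poset D le" and y: "y \<^bold>\<in> D" and le: "PROP le x y"
    and sup: "PROP is_sup D le (conditional_pair x y (PROP P)) s" and P: "PROP P"
  shows "s \<equiv> y"
proof (rule poset_antisym[OF po is_sup_in[OF sup] y])
  show "PROP le s y"
    by (rule is_sup_least[OF sup y conditional_pair_le[OF po y le]])
  show "PROP le y s"
    by (rule is_sup_upper[OF sup conditional_pair_right[OF P]])
qed

text \<open>Openness yields a member of the pair inside \<open>U\<close>. It cannot be
  \<open>x\<close>, so it is \<open>y\<close>, whose membership in the pair contains a proof of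
  \<open>P\<close>.\<close>

lemma conditional_pair_sup_open:
  fixes D :: "('a::{}) pset"
  assumes dir: "PROP directed D le (conditional_pair x y (PROP P))"
    and sup: "PROP is_sup D le (conditional_pair x y (PROP P)) s"
    and U: "PROP scott_open D le U" and s: "s \<^bold>\<in> U" and x: "\<^bold>\<not> x \<^bold>\<in> U"
  shows "PROP P"
  using scott_open_sup[OF U dir sup s]
proof (rule ex_propE)
  fix t
  assume t: "t \<^bold>\<in> conditional_pair x y (PROP P) \<^bold>\<and> t \<^bold>\<in> U"
  from conj_propD1[OF t] show "PROP P"
  proof (rule conditional_pairE)
    assume "t \<equiv> x"
    show "PROP P"
      by (rule negE[OF x conj_propD2[OF t, unfolded \<open>t \<equiv> x\<close>]])
  next
    assume "PROP P"
    then show "PROP P" .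
  qed
qed

section \<open>Excluded middle from a comparable apart pair\<close>

text \<open>A doubly negated \<open>P\<close> prevents \<open>s\<close> from being apart from
  \<open>y\<close>, so tightness identifies them. A Scott open set separating \<open>y\<close> from
  \<open>x\<close> then contains \<open>s\<close>, and this reveals \<open>P\<close>.\<close>

lemma tight_imp_excluded_middle:
  fixes D :: "('a::{}) pset"
  assumes dcpo: "PROP dcpo D le" and x: "x \<^bold>\<in> D" and y: "y \<^bold>\<in> D" and le: "PROP le x y"
    and ap: "PROP apart D le x y" and tight: "PROP tight D (apart D le)"
  shows "PROP excluded_middle"
proof (rule excluded_middle_if_double_negation)
  fix P :: "prop"
  assume nnP: "\<^bold>\<not> \<^bold>\<not> PROP P"
  note po = dcpo_poset[OF dcpo]
  have dir: "PROP directed D le (conditional_pair x y (PROP P))"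
    by (rule conditional_pair_directed[OF po x y le])
  from dcpo_sup[OF dcpo dir] show "PROP P"
  proof (rule ex_propE)
    fix s
    assume sup: "PROP is_sup D le (conditional_pair x y (PROP P)) s"
    have "\<^bold>\<not> PROP apart D le s y"
    proof (rule negI)
      assume sy: "PROP apart D le s y"
      \<comment> \<open>A proof of \<open>P\<close> would turn \<open>sy\<close> into an apartness
        of \<open>y\<close> from itself; the resulting refutation of \<open>P\<close> contradicts
        \<open>nnP\<close>.\<close>
      have "\<^bold>\<not> PROP P"
      proof (rule negI)
        assume "PROP P"
        then have "s \<equiv> y"
          by (rule conditional_pair_sup_eq[OF po y le sup])
        show "\<^bold>\<bottom>"
          by (rule negD[OF apart_irrefl sy[unfolded \<open>s \<equiv> y\<close>]])
      qed
      then show "\<^bold>\<bottom>"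
        by (rule negD[OF nnP])
    qed
    then have "s \<equiv> y"
      by (rule tight[unfolded tight_def, rule_format, OF is_sup_in[OF sup] y])
    from apart_above[OF y le ap] show "PROP P"
    proof (rule not_below_scottE)
      fix U
      assume U: "PROP scott_open D le U" and yU: "y \<^bold>\<in> U" and xU: "\<^bold>\<not> x \<^bold>\<in> U"
      have "s \<^bold>\<in> U"
        unfolding \<open>s \<equiv> y\<close> by (rule yU)
      then show "PROP P"
        by (rule conditional_pair_sup_open[OF dir sup U _ xU])
    qed
  qed
qed

text \<open>The supremum \<open>s\<close> is the third point for cotransitivity. Apartness of
  \<open>x\<close> from \<open>s\<close> proves \<open>P\<close> because \<open>x\<close> is below
  \<open>s\<close>; apartness of \<open>y\<close> from \<open>s\<close> refutes \<open>P\<close>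
  because \<open>P\<close> would give \<open>s \<equiv> y\<close>.\<close>

lemma cotransitive_imp_excluded_middle:
  fixes D :: "('a::{}) pset"
  assumes dcpo: "PROP dcpo D le" and x: "x \<^bold>\<in> D" and y: "y \<^bold>\<in> D" and le: "PROP le x y"
    and ap: "PROP apart D le x y" and cotrans: "PROP cotransitive D (apart D le)"
  shows "PROP excluded_middle"
  unfolding excluded_middle_def
proof -
  fix P :: "prop"
  note po = dcpo_poset[OF dcpo]
  have dir: "PROP directed D le (conditional_pair x y (PROP P))"
    by (rule conditional_pair_directed[OF po x y le])
  from dcpo_sup[OF dcpo dir] show "PROP P \<^bold>\<or> \<^bold>\<not> PROP P"
  proof (rule ex_propE)
    fix s
    assume sup: "PROP is_sup D le (conditional_pair x y (PROP P)) s"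
    note s = is_sup_in[OF sup]
    from cotrans[unfolded cotransitive_def, rule_format, OF x y s ap] show "PROP P \<^bold>\<or> \<^bold>\<not> PROP P"
    proof (rule disj_propE)
      assume "PROP apart D le x s"
      from apart_above[OF s is_sup_upper[OF sup conditional_pair_left] this]
      have "PROP P"
      proof (rule not_below_scottE)
        fix U
        assume "PROP scott_open D le U" and "s \<^bold>\<in> U" and "\<^bold>\<not> x \<^bold>\<in> U"
        then show "PROP P"
          by (rule conditional_pair_sup_open[OF dir sup])
      qed
      then show "PROP P \<^bold>\<or> \<^bold>\<not> PROP P"
        by (rule disj_propI1)
    next
      assume ys: "PROP apart D le y s"
      have "\<^bold>\<not> PROP P"
      proof (rule negI)
        assume "PROP P"
        then have "s \<equiv> y"
          by (rule conditional_pair_sup_eq[OF po y le sup])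
        show "\<^bold>\<bottom>"
          by (rule negD[OF apart_irrefl ys[unfolded \<open>s \<equiv> y\<close>]])
      qed
      then show "PROP P \<^bold>\<or> \<^bold>\<not> PROP P"
        by (rule disj_propI2)
    qed
  qed
qed


subsection \<open>The Sierpinski domain\<close>

text \<open>Rests on extensionality in Pure: \<open>equal_intr_rule\<close> makes mutually implying
  propositions equal, and abstraction over \<open>x\<close> lifts this to predicates.\<close>

lemma incl_antisym:
  fixes A B :: "('a::{}) pset"
  assumes AB: "A \<^bold>\<subseteq> B" and BA: "B \<^bold>\<subseteq> A"
  shows "A \<equiv> B"
proof -
  have eq: "x \<^bold>\<in> A \<equiv> x \<^bold>\<in> B" for x
    by (rule equal_intr_rule) (erule inclD[OF AB], erule inclD[OF BA])
  show "A \<equiv> B"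
    by (rule eq[abs_def])
qed

lemma poset_incl:
  fixes D :: "('a::{}) pset pset"
  shows "PROP poset D incl"
  unfolding poset_def
proof (rule conj_propI[OF _ conj_propI])
  fix A :: "'a pset"
  show "A \<^bold>\<subseteq> A"
    by (rule inclI)
next
  fix A B C :: "'a pset"
  assume AB: "A \<^bold>\<subseteq> B" and BC: "B \<^bold>\<subseteq> C"
  show "A \<^bold>\<subseteq> C"
    by (rule inclI) (erule inclD[OF BC inclD[OF AB]])
next
  fix A B :: "'a pset"
  assume "A \<^bold>\<subseteq> B" and "B \<^bold>\<subseteq> A"
  then show "A \<equiv> B"
    by (rule incl_antisym)
qed

definition union :: "('a::{}) pset pset \<Rightarrow> 'a pset"
  where "union S \<equiv> (\<lambda>x. \<^bold>\<exists>A. A \<^bold>\<in> S \<^bold>\<and> x \<^bold>\<in> A)"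

lemma union_incl:
  fixes S :: "('a::{}) pset pset"
  assumes S: "\<And>A. A \<^bold>\<in> S \<Longrightarrow> A \<^bold>\<subseteq> B"
  shows "union S \<^bold>\<subseteq> B"
proof (rule inclI)
  fix x
  assume "x \<^bold>\<in> union S"
  from this[unfolded union_def] show "x \<^bold>\<in> B"
  proof (rule ex_propE)
    fix A
    assume A: "A \<^bold>\<in> S \<^bold>\<and> x \<^bold>\<in> A"
    show "x \<^bold>\<in> B"
      by (rule inclD[OF S[OF conj_propD1[OF A]] conj_propD2[OF A]])
  qed
qed

lemma incl_union:
  fixes S :: "('a::{}) pset pset"
  assumes A: "A \<^bold>\<in> S"
  shows "A \<^bold>\<subseteq> union S"
proof (rule inclI)
  fix x
  assume x: "x \<^bold>\<in> A"
  show "x \<^bold>\<in> union S"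
    unfolding union_def by (rule ex_propI[of _ A]) (rule conj_propI[OF A x])
qed

lemma union_in_powerset:
  fixes X :: "('a::{}) pset"
  assumes dir: "PROP directed (powerset X) incl S"
  shows "union S \<^bold>\<in> powerset X"
  unfolding powerset_def
  by (rule union_incl) (erule directed_subset[OF dir, unfolded powerset_def])

text \<open>Directed suprema are unions, so \<open>union S\<close> is the explicit witness.\<close>

lemma dcpo_powerset:
  fixes X :: "('a::{}) pset"
  shows "PROP dcpo (powerset X) incl"
  unfolding dcpo_def
proof (rule conj_propI[OF poset_incl])
  fix S
  assume dir: "PROP directed (powerset X) incl S"
  have "PROP is_sup (powerset X) incl S (union S)"
    unfolding is_sup_def
    by (rule conj_propI[OF union_in_powerset[OF dir]], rule conj_propI, erule incl_union,
        rule union_incl)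
  then show "\<^bold>\<exists>s. PROP is_sup (powerset X) incl S s"
    by (rule ex_propI[of _ "union S"])
qed

text \<open>An element of a union already lies in one of the sets being united, so containing a
  fixed point \<open>x\<close> is a Scott open condition.\<close>

lemma scott_open_powerset_mem:
  fixes X :: "('a::{}) pset"
  shows "PROP scott_open (powerset X) incl (\<lambda>A. A \<^bold>\<in> powerset X \<^bold>\<and> x \<^bold>\<in> A)"
proof (rule scott_openI)
  fix A
  assume "A \<^bold>\<in> powerset X \<^bold>\<and> x \<^bold>\<in> A"
  then show "A \<^bold>\<in> powerset X"
    by (rule conj_propD1)
next
  fix A B
  assume A: "A \<^bold>\<in> powerset X \<^bold>\<and> x \<^bold>\<in> A" and B: "B \<^bold>\<in> powerset X" and AB: "A \<^bold>\<subseteq> B"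
  show "B \<^bold>\<in> powerset X \<^bold>\<and> x \<^bold>\<in> B"
    by (rule conj_propI[OF B inclD[OF AB conj_propD2[OF A]]])
next
  fix S s
  assume dir: "PROP directed (powerset X) incl S" and sup: "PROP is_sup (powerset X) incl S s"
    and s: "s \<^bold>\<in> powerset X \<^bold>\<and> x \<^bold>\<in> s"
  \<comment> \<open>\<open>s\<close> is an arbitrary supremum of \<open>S\<close>; it is compared
    with the union through leastness.\<close>
  have le: "s \<^bold>\<subseteq> union S"
    by (rule is_sup_least[OF sup, OF union_in_powerset[OF dir]]) (rule incl_union)
  have "x \<^bold>\<in> union S"
    by (rule inclD[OF le, OF conj_propD2[OF s]])
  from this[unfolded union_def]
  show "\<^bold>\<exists>A. A \<^bold>\<in> S \<^bold>\<and> A \<^bold>\<in> powerset X \<^bold>\<and> x \<^bold>\<in> A"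
  proof (rule ex_propE)
    fix A
    assume A: "A \<^bold>\<in> S \<^bold>\<and> x \<^bold>\<in> A"
    note AS = conj_propD1[OF A]
    show "\<^bold>\<exists>A. A \<^bold>\<in> S \<^bold>\<and> A \<^bold>\<in> powerset X \<^bold>\<and> x \<^bold>\<in> A"
      by (rule ex_propI[of _ A])
        (rule conj_propI[OF AS conj_propI[OF directed_subset[OF dir, OF AS] conj_propD2[OF A]]])
  qed
qed

section \<open>The empty and the full subset of the singleton\<close>

lemma Sierpinski_bottom: "(\<lambda>_. \<^bold>\<bottom>) \<^bold>\<in> Sierpinski"
  unfolding Sierpinski_def powerset_def by (rule inclI) (erule falsumE)

lemma Sierpinski_top: "singleton () \<^bold>\<in> Sierpinski"
  unfolding Sierpinski_def powerset_def by (rule inclI)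

text \<open>The subsets containing \<open>()\<close> form a Scott open set that has the full subset
  as a member but not the empty one.\<close>

lemma Sierpinski_apart: "PROP apart Sierpinski incl (\<lambda>_. \<^bold>\<bottom>) (singleton ())"
proof (rule apartI2[OF not_below_scottI])
  show "PROP scott_open Sierpinski incl (\<lambda>A. A \<^bold>\<in> Sierpinski \<^bold>\<and> () \<^bold>\<in> A)"
    unfolding Sierpinski_def by (rule scott_open_powerset_mem)
  show "singleton () \<^bold>\<in> Sierpinski \<^bold>\<and> () \<^bold>\<in> singleton ()"
    by (rule conj_propI[OF Sierpinski_top]) (unfold singleton_def, rule reflexive)
  \<comment> \<open>The second conjunct is membership of \<open>()\<close> in the empty subset,
    already reduced to \<open>falsum\<close>.\<close>
  show "\<^bold>\<not> ((\<lambda>_. \<^bold>\<bottom>) \<^bold>\<in> Sierpinski \<^bold>\<and> \<^bold>\<bottom>)"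
    by (rule negI) (erule conj_propD2)
qed

text \<open>The empty subset lies below the full one and is apart from it, so this pair instantiates
  the two results for general dcpos.\<close>

lemma Sierpinski_imp_excluded_middle:
  assumes "PROP tight Sierpinski (apart Sierpinski incl) \<^bold>\<or>
    PROP cotransitive Sierpinski (apart Sierpinski incl)"
  shows "PROP excluded_middle"
proof -
  have dcpo: "PROP dcpo Sierpinski incl"
    unfolding Sierpinski_def by (rule dcpo_powerset)
  have le: "(\<lambda>_. \<^bold>\<bottom>) \<^bold>\<subseteq> singleton ()"
    by (rule inclI) (erule falsumE)
  note facts = dcpo Sierpinski_bottom Sierpinski_top le Sierpinski_apart
  from assms show "PROP excluded_middle"
    by (rule disj_propE)
      (erule tight_imp_excluded_middle[OF facts], erule cotransitive_imp_excluded_middle[OF facts])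
qed

theorem theorem5p7:
  shows
    "((PROP excluded_middle \<Longrightarrow>
        (\<And>(D :: ('a::{}) pset) le. PROP dcpo D le \<Longrightarrow> PROP tight D (apart D le)))
      \<^bold>\<and> (\<And>(D :: ('a::{}) pset) le.
            PROP continuous_dcpo D le \<Longrightarrow>
            (\<^bold>\<exists>x y. x \<^bold>\<in> D \<^bold>\<and> y \<^bold>\<in> D \<^bold>\<and> PROP le x y \<^bold>\<and> PROP apart D le x y) \<Longrightarrow>
            PROP tight D (apart D le) \<Longrightarrow>
            PROP excluded_middle))
     \<^bold>\<and>
     ((PROP excluded_middle \<Longrightarrow>
        (\<And>(D :: ('a::{}) pset) le. PROP dcpo D le \<Longrightarrow> PROP cotransitive D (apart D le)))
      \<^bold>\<and> (\<And>(D :: ('a::{}) pset) le.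
            PROP continuous_dcpo D le \<Longrightarrow>
            (\<^bold>\<exists>x y. x \<^bold>\<in> D \<^bold>\<and> y \<^bold>\<in> D \<^bold>\<and> PROP le x y \<^bold>\<and> PROP apart D le x y) \<Longrightarrow>
            PROP cotransitive D (apart D le) \<Longrightarrow>
            PROP excluded_middle))
     \<^bold>\<and>
     (PROP tight Sierpinski (apart Sierpinski incl) \<^bold>\<or>
        PROP cotransitive Sierpinski (apart Sierpinski incl) \<Longrightarrow>
      PROP excluded_middle)"
proof (rule conj_propI[OF conj_propI conj_propI[OF conj_propI]])
  fix D :: "'a pset" and le
  assume "PROP excluded_middle" and "PROP dcpo D le"
  then show "PROP tight D (apart D le)"
    by (rule excluded_middle_imp_tight)
next
  fix D :: "'a pset" and le
  assume cont: "PROP continuous_dcpo D le"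
    and ex: "\<^bold>\<exists>x y. x \<^bold>\<in> D \<^bold>\<and> y \<^bold>\<in> D \<^bold>\<and> PROP le x y \<^bold>\<and> PROP apart D le x y"
    and tight: "PROP tight D (apart D le)"
  from ex show "PROP excluded_middle"
    \<comment> \<open>The four open premises of the rule are the facts about the pair obtained from
      \<open>ex\<close>.\<close>
    by (elim ex_propE conj_propE)
      (rule tight_imp_excluded_middle[OF continuous_dcpo_dcpo[OF cont] _ _ _ _ tight])
next
  fix D :: "'a pset" and le
  assume "PROP excluded_middle"
  then show "PROP cotransitive D (apart D le)"
    by (rule excluded_middle_imp_cotransitive)
next
  fix D :: "'a pset" and le
  assume cont: "PROP continuous_dcpo D le"
    and ex: "\<^bold>\<exists>x y. x \<^bold>\<in> D \<^bold>\<and> y \<^bold>\<in> D \<^bold>\<and> PROP le x y \<^bold>\<and> PROP apart D le x y"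
    and cotrans: "PROP cotransitive D (apart D le)"
  from ex show "PROP excluded_middle"
    by (elim ex_propE conj_propE)
      (rule cotransitive_imp_excluded_middle[OF continuous_dcpo_dcpo[OF cont] _ _ _ _ cotrans])
next
  assume "PROP tight Sierpinski (apart Sierpinski incl) \<^bold>\<or>
    PROP cotransitive Sierpinski (apart Sierpinski incl)"
  then show "PROP excluded_middle"
    by (rule Sierpinski_imp_excluded_middle)
qed

end
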